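(* Let $p$ be a prime number and $n$ an integer with $n\geq 3$ and $p>n$. Let $N_1,N_2$ be abelian groups of order $p^n$. Let $G$ be a group and $G'\subset G$ a subgroup with $[G:G']=p^n$. If the pairs $(G,N_1)$ and $(G,N_2)$ are both realizable (with respect to the same subgroup $G'$), then $N_1\simeq N_2$.
   Context: For a finite group $N$ with identity $e_N$, the holomorph $\mathrm{Hol}(N)$ is the normalizer in $\mathrm{Sym}(N)$ of the image of the left regular representation $\lambda_N:N\to \mathrm{Sym}(N)$. As an abstract group, $\mathrm{Hol}(N)=N\rtimes\mathrm{Aut}(N)$, with product $(x,\varphi)(y,\psi)=(x\varphi(y),\varphi\psi)$, and $(x,\varphi)$ acts on $N$ by $y\mapsto x\varphi(y)$. Let $G$ be a finite group, $G'\subset G$ a subgroup, and $N$ a group of order $[G:G']$. The pair $(G,N)$ is called realizable (with respect to $G'$) if there exists a group monomorphism $\beta:G\hookrightarrow \mathrm{Hol}(N)$ such that $\beta(G')$ is the stabilizer of $e_N$ in $\beta(G)$. (By theorems of Greither–Pareigis, Childs and Byott, this is equivalent to the following: a separable field extension $L/K$ of degree $|N|$ with normal closure $\widetilde L$, $\mathrm{Gal}(\widetilde L/K)\simeq G$ and $\mathrm{Gal}(\widetilde L/L)$ corresponding to $G'$, has a Hopf Galois structure of type $N$. Here a Hopf Galois structure on $L/K$ corresponds to a regular subgroup of $\mathrm{Sym}(G/G')$ normalized by the image of $G$ acting by left translation on $G/G'$, and its type is the isomorphism class of that regular subgroup.) *)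

theory Defs
  imports "HOL-Algebra.Algebra" "HOL-Computational_Algebra.Primes"
begin

definition left_regular :: "('a, 'b) monoid_scheme \<Rightarrow> 'a \<Rightarrow> 'a \<Rightarrow> 'a"
  where "left_regular N x = (\<lambda>y \<in> carrier N. x \<otimes>\<^bsub>N\<^esub> y)"

definition holomorph :: "('a, 'b) monoid_scheme \<Rightarrow> ('a \<Rightarrow> 'a) monoid"
  where "holomorph N =
    (BijGroup (carrier N))
      \<lparr>carrier := normalizer (BijGroup (carrier N)) (left_regular N ` carrier N)\<rparr>"

text \<open>Since \<open>G\<close> is finite, the index \<open>card (rcosets\<^bsub>G\<^esub> G')\<close> is positive, so the condition on
  \<open>order N\<close> also makes \<open>N\<close> finite.\<close>

definition realizable ::
    "('g, 'c) monoid_scheme \<Rightarrow> 'g set \<Rightarrow> ('a, 'b) monoid_scheme \<Rightarrow> bool"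
  where "realizable G G' N \<longleftrightarrow>
    group G \<and> finite (carrier G) \<and> subgroup G' G \<and>
    group N \<and> order N = card (rcosets\<^bsub>G\<^esub> G') \<and>
    (\<exists>\<beta> \<in> mon G (holomorph N).
      \<beta> ` G' = stabilizer ((holomorph N)\<lparr>carrier := \<beta> ` carrier G\<rparr>) (\<lambda>f. f) \<one>\<^bsub>N\<^esub>)"

lemma left_regular_in_Bij:
  assumes "group N" and "x \<in> carrier N"
  shows "left_regular N x \<in> Bij (carrier N)"
proof -
  interpret group N by fact
  have "bij_betw (\<lambda>y. x \<otimes>\<^bsub>N\<^esub> y) (carrier N) (carrier N)"
    using assms(2) inj_on_multc surj_const_mult inj_on_cmult by (simp add: bij_betw_def)
  then show ?thesis
    by (simp add: Bij_def left_regular_def)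
qed

lemma group_holomorph:
  assumes "group N"
  shows "group (holomorph N)"
proof -
  have "left_regular N ` carrier N \<subseteq> carrier (BijGroup (carrier N))"
    using left_regular_in_Bij[OF assms] by (auto simp: BijGroup_def)
  then show ?thesis
    unfolding holomorph_def
    by (intro group.subgroup_imp_group group.normalizer_imp_subgroup group_BijGroup)
qed

end

theory Submission
  imports Defs
begin

text \<open>
  Write \<open>N\<close> for either of the two abelian groups. The reason for the theorem is that the
  permutation action of \<open>G\<close> on the cosets of \<open>G'\<close> already determines how many elements of
  \<open>N\<close> are killed by \<open>p\<^sup>k\<close>, for every \<open>k\<close>; and these numbers determine a finite abelian
  \<open>p\<close>-group up to isomorphism.

  A realization makes \<open>G\<close> act on \<open>N\<close> by affine maps \<open>f: y \<mapsto> x \<cdot> \<phi>(y)\<close> with \<open>\<phi>\<close> an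
  endomorphism, in such a way that \<open>G'\<close> is the stabilizer of the identity. Because \<open>[G:G']\<close> is a power of
  \<open>p\<close>, a Sylow \<open>p\<close>-subgroup \<open>P\<close> of \<open>G\<close> still acts transitively. Take \<open>g \<in> P\<close>, acting as \<open>f\<close>.
  In additive notation \<open>f\<^sup>i(0) = \<Sum>\<^sub>j (i choose j+1) D\<^sup>j x\<close> where \<open>D = \<phi> - 1\<close>, by Newton's forward
  difference formula. As \<open>\<phi>\<close> has \<open>p\<close>-power order, \<open>D\<close> is nilpotent, and as \<open>N\<close> has order
  \<open>p\<^sup>n\<close>, even \<open>D\<^sup>n = 0\<close>. Since \<open>p > n\<close>, every binomial coefficient \<open>(p\<^sup>k choose j+1)\<close> that
  survives is divisible by \<open>p\<^sup>k\<close>, so \<open>f\<close> iterated \<open>p\<^sup>k\<close> times takes \<open>0\<close> to a unipotent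
  operator applied to \<open>p\<^sup>k x\<close>. Hence it fixes \<open>0\<close> exactly if \<open>p\<^sup>k x = 0\<close>
  (\<open>affine_prime_power_fixes_one_iff\<close>): the element \<open>g\<close> to the power \<open>p\<^sup>k\<close> lies in \<open>G'\<close> if and only
  if the point to which \<open>g\<close> moves the identity is killed by \<open>p\<^sup>k\<close>.

  Each point of \<open>N\<close> is hit by the same number \<open>|P \<inter> G'|\<close> of elements of \<open>P\<close>, so
  \<open>|{g \<in> P. g^(p\<^sup>k) \<in> G'}| = |P \<inter> G'| \<cdot> |N[p\<^sup>k]|\<close>
  (\<open>card_prime_power_roots_of_stabilizer\<close>). The left-hand side does not mention \<open>N\<close>; comparing it
  for the two groups shows that their torsion subgroups have equal sizes, and
  \<open>comm_p_groups_iso_if_torsion_eq\<close> finishes the proof.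
\<close>

section \<open>Forward differences and binomial coefficients of prime powers\<close>

text \<open>
  The array \<open>c j i\<close> is the table of iterated differences of the sequence \<open>c 0\<close>, written
  multiplicatively; the induction step is Pascal's rule, with the induction hypothesis applied both
  to the table and to the table with its first row removed.
\<close>

lemma (in comm_monoid) newton_forward_difference:
  assumes closed: "\<And>j i. c j i \<in> carrier G"
    and step: "\<And>j i. c j (Suc i) = c j i \<otimes> c (Suc j) i"
  shows "c 0 i = (\<Otimes>j\<in>{..i}. c j 0 [^] (i choose j))"
  using assms
proof (induction i arbitrary: c)
  case 0
  then show ?case by simp
next
  case (Suc i)
  let ?f = "\<lambda>j. c (Suc j) 0 [^] (i choose Suc j)"
  let ?g = "\<lambda>j. c (Suc j) 0 [^] (i choose j)"
  have "c 0 i = (\<Otimes>j\<in>{..i}. c j 0 [^] (i choose j))"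
    using Suc by blast
  also have "\<dots> = (\<Otimes>j\<in>{..Suc i}. c j 0 [^] (i choose j))"
    using Suc.prems by (subst finprod_Suc) (auto simp: binomial_eq_0)
  also have "\<dots> = (\<Otimes>j\<in>{..i}. ?f j) \<otimes> c 0 0"
    using Suc.prems by (subst finprod_Suc2) auto
  finally have c0: "c 0 i = (\<Otimes>j\<in>{..i}. ?f j) \<otimes> c 0 0" .
  have c1: "c 1 i = (\<Otimes>j\<in>{..i}. ?g j)"
    using Suc.IH[of "\<lambda>j. c (Suc j)"] Suc.prems by simp
  have "c 0 (Suc i) = (\<Otimes>j\<in>{..i}. ?f j) \<otimes> c 0 0 \<otimes> (\<Otimes>j\<in>{..i}. ?g j)"
    using Suc.prems(2)[of 0 i] c0 c1 by simp
  also have "\<dots> = (\<Otimes>j\<in>{..i}. ?g j) \<otimes> (\<Otimes>j\<in>{..i}. ?f j) \<otimes> c 0 0"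
    using Suc.prems(1) by (simp add: m_ac)
  also have "(\<Otimes>j\<in>{..i}. ?g j) \<otimes> (\<Otimes>j\<in>{..i}. ?f j) = (\<Otimes>j\<in>{..i}. ?g j \<otimes> ?f j)"
    using Suc.prems(1) by (subst finprod_multf) auto
  also have "\<dots> = (\<Otimes>j\<in>{..i}. c (Suc j) 0 [^] (Suc i choose Suc j))"
    using Suc.prems(1) by (simp add: nat_pow_mult)
  also have "\<dots> \<otimes> c 0 0 = (\<Otimes>j\<in>{..Suc i}. c j 0 [^] (Suc i choose j))"
    using Suc.prems(1) by (subst finprod_Suc2) auto
  finally show ?case .
qed

text \<open>
  Both divisibility facts come from \<open>j (q choose j) = q (q - 1 choose j - 1)\<close> for \<open>q = p\<^sup>k\<close>. Here
  \<open>j < p\<close> makes \<open>j\<close> coprime to \<open>q\<close>, so that all of \<open>q\<close> divides the binomial coefficient; in the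
  next lemma a coefficient prime to \<open>p\<close> would force \<open>q dvd j\<close>, against \<open>0 < j < q\<close>.
\<close>

lemma prime_power_dvd_binomial:
  fixes p :: nat
  assumes "Factorial_Ring.prime p" "0 < j" "j < p"
  shows "p ^ k dvd (p ^ k choose j)"
proof -
  have "p ^ k dvd j * (p ^ k choose j)"
    using assms(2) by (simp add: times_binomial_minus1_eq)
  moreover have "coprime (p ^ k) j"
    using assms by (simp add: prime_imp_coprime nat_dvd_not_less)
  ultimately show ?thesis
    by (simp add: coprime_dvd_mult_right_iff)
qed

lemma prime_dvd_prime_power_binomial:
  fixes p :: nat
  assumes "Factorial_Ring.prime p" "0 < j" "j < p ^ k"
  shows "p dvd (p ^ k choose j)"
proof (rule ccontr)
  assume "\<not> p dvd (p ^ k choose j)"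
  then have "coprime (p ^ k) (p ^ k choose j)"
    using assms by (simp add: prime_imp_coprime)
  moreover have "p ^ k dvd j * (p ^ k choose j)"
    using assms(2) by (simp add: times_binomial_minus1_eq)
  ultimately have "p ^ k dvd j"
    by (simp add: coprime_dvd_mult_left_iff)
  then show False
    using assms by (simp add: nat_dvd_not_less)
qed

section \<open>Nilpotent endomorphisms of p-groups\<close>

lemma hom_funpow:
  assumes "h \<in> hom G G"
  shows "h ^^ i \<in> hom G G"
  using assms by (induction i) (auto simp: hom_def Pi_def)

lemma (in comm_group) hom_finprod_atMost:
  assumes h: "h \<in> hom G G" and f: "\<And>j. f j \<in> carrier G"
  shows "h (\<Otimes>j\<in>{..m::nat}. f j) = (\<Otimes>j\<in>{..m}. h (f j))"
proof -
  have "h (f j) \<in> carrier G" for j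
    using h f by (auto simp: hom_def)
  with f show ?thesis
    by (induction m) (simp_all add: hom_mult[OF h] Pi_def)
qed

text \<open>
  In additive notation, let \<open>\<Sum>\<^sub>j b\<^sub>j D\<^sup>j x = 0\<close> and \<open>D\<^sup>i\<^sup>+\<^sup>1 x = 0\<close>. Applying \<open>D\<^sup>i\<close> to the sum kills
  every term but \<open>b\<^sub>0 D\<^sup>i x\<close>, so \<open>D\<^sup>i x = 0\<close> because \<open>b\<^sub>0 = 1\<close>; descending in \<open>i\<close> ends with \<open>x = 0\<close>.
\<close>

lemma (in comm_group) nilpotent_combination_eq_one:
  assumes D: "D \<in> hom G G" and x: "x \<in> carrier G" and "(D ^^ n) x = \<one>"
    and b0: "b 0 = (1::nat)" and prod: "(\<Otimes>j\<in>{..m::nat}. (D ^^ j) x [^] b j) = \<one>"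
  shows "x = \<one>"
  using \<open>(D ^^ n) x = \<one>\<close>
proof (induction n)
  case 0
  then show ?case by simp
next
  case (Suc n)
  have clos: "(D ^^ i) x \<in> carrier G" for i
    using hom_funpow[OF D] x by (auto simp: hom_def)
  have Dn: "D ^^ n \<in> hom G G" by (rule hom_funpow[OF D])
  have D1: "(D ^^ i) \<one> = \<one>" for i
    using hom_one[OF hom_funpow[OF D]] by simp
  have van: "(D ^^ (n + Suc j)) x = \<one>" for j
    using Suc.prems D1[of j] by (metis add.commute add_Suc_shift comp_apply funpow_add)
  have "\<one> = (D ^^ n) (\<Otimes>j\<in>{..m}. (D ^^ j) x [^] b j)"
    by (simp add: prod D1)
  also have "\<dots> = (\<Otimes>j\<in>{..m}. (D ^^ (n + j)) x [^] b j)"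
    using clos hom_nat_pow[OF Dn clos is_group is_group]
    by (subst hom_finprod_atMost[OF Dn]) (auto simp: funpow_add)
  also have "\<dots> = (D ^^ n) x"
  proof (cases m)
    case 0
    then show ?thesis using clos b0 by simp
  next
    case m: (Suc m')
    have "(\<Otimes>j\<in>{..m}. (D ^^ (n + j)) x [^] b j)
        = (\<Otimes>j\<in>{..m'}. (D ^^ (n + Suc j)) x [^] b (Suc j)) \<otimes> (D ^^ n) x"
      using clos b0 unfolding m by (subst finprod_Suc2) auto
    then show ?thesis
      using clos by (simp add: van del: add_Suc_right)
  qed
  finally show ?case
    using Suc.IH by simp
qed

lemma (in group) prime_power_exponent_of_order:
  assumes "Factorial_Ring.prime p" "order G = p ^ n" "x \<in> carrier G"
  obtains f where "f \<le> n" "ord x = p ^ f"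
  using assms ord_dvd_group_order[OF assms(3)] divides_primepow_nat[of p "ord x" n] by auto

lemma (in group) exists_element_of_prime_order:
  assumes "Factorial_Ring.prime p" "order G = p ^ n" "subgroup M G" "M \<noteq> {\<one>}"
  obtains y where "y \<in> M" "y \<noteq> \<one>" "y [^] p = \<one>"
proof -
  obtain z where z: "z \<in> M" "z \<noteq> \<one>"
    using assms(3,4) subgroup.one_closed by blast
  have zc: "z \<in> carrier G" using z assms(3) subgroup.mem_carrier by metis
  obtain f where f: "ord z = p ^ f"
    using prime_power_exponent_of_order[OF assms(1,2) zc] by metis
  have "f \<noteq> 0" using f z zc ord_eq_1 by (metis power_0)
  then obtain f' where f': "f = Suc f'" using not0_implies_Suc by blast
  have "1 < p" using assms(1) prime_gt_1_nat by simp
  define y where "y = z [^] (p ^ f')"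
  have "y [^] p = \<one>"
    unfolding y_def using zc f f' by (simp add: nat_pow_pow pow_eq_id mult.commute)
  moreover have "y \<noteq> \<one>"
    unfolding y_def using zc f f' \<open>1 < p\<close> by (simp add: pow_eq_id nat_dvd_not_less)
  moreover have "y \<in> M"
    unfolding y_def using subgroup_int_pow_closed[OF assms(3) z(1)] by (metis int_pow_int)
  ultimately show thesis using that by blast
qed

text \<open>
  The images of the powers of \<open>D\<close> form a descending chain of subgroups. As long as such an image is
  nontrivial it contains an element of order \<open>p\<close>, on which \<open>D\<close> is nilpotent by assumption; so \<open>D\<close> is
  not injective there and the next image is smaller, hence smaller by a factor of at least \<open>p\<close>. This
  can happen at most \<open>n\<close> times.
\<close>

lemma (in group) hom_nilpotent:
  assumes p: "Factorial_Ring.prime p" and ord: "order G = p ^ n"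
    and D: "D \<in> hom G G"
    and tors: "\<And>y. \<lbrakk>y \<in> carrier G; y [^] p = \<one>\<rbrakk> \<Longrightarrow> (D ^^ r) y = \<one>"
    and y: "y \<in> carrier G"
  shows "(D ^^ n) y = \<one>"
proof -
  have fin: "finite (carrier G)"
    using ord p by (metis order_gt_0_iff_finite prime_gt_0_nat zero_less_power)
  define M where "M j = (D ^^ j) ` carrier G" for j
  have D1: "(D ^^ i) \<one> = \<one>" for i
    using hom_one[OF hom_funpow[OF D]] is_group by simp
  have subM: "subgroup (M j) G" for j
  proof -
    interpret group_hom G G "D ^^ j"
      by unfold_locales (rule hom_funpow[OF D])
    show ?thesis unfolding M_def by (rule img_is_subgroup)
  qed
  have finM: "finite (M j)" for j using fin by (simp add: M_def)
  have M_Suc: "M (Suc j) = D ` M j" for j by (auto simp: M_def)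
  have M_sub: "M (Suc j) \<subseteq> M j" for j
    unfolding M_def funpow_Suc_right using D by (auto simp: hom_def)
  have shrink: "card (M (Suc j)) < card (M j)" if nt: "M j \<noteq> {\<one>}" for j
  proof -
    obtain y where y: "y \<in> M j" "y \<noteq> \<one>" "y [^] p = \<one>"
      using exists_element_of_prime_order[OF p ord subM nt] .
    have yc: "y \<in> carrier G" using y subM subgroup.mem_carrier by metis
    \<comment> \<open>The last nontrivial iterate \<open>w\<close> of \<open>y\<close> under \<open>D\<close> lies in the kernel of \<open>D\<close>.\<close>
    define s where "s = (LEAST s. (D ^^ s) y = \<one>)"
    have s: "(D ^^ s) y = \<one>"
      unfolding s_def using tors[OF yc y(3)] by (rule LeastI)
    with y(2) have "s \<noteq> 0" by (cases s) auto
    then obtain t where t: "s = Suc t" using not0_implies_Suc by blast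
    define w where "w = (D ^^ t) y"
    have "w \<noteq> \<one>"
      unfolding w_def using not_less_Least[of t "\<lambda>s. (D ^^ s) y = \<one>"] t s_def by simp
    moreover have "D w = \<one>" using s t by (simp add: w_def)
    moreover have "D \<one> = \<one>" using D1[of 1] by simp
    moreover have "(D ^^ i) y \<in> M j" for i
    proof (induction i)
      case (Suc i)
      then have "D ((D ^^ i) y) \<in> M (Suc j)" by (simp add: M_Suc)
      then show ?case using M_sub by auto
    qed (use y in simp)
    then have "w \<in> M j" by (simp add: w_def)
    ultimately have "\<not> inj_on D (M j)"
      using subgroup.one_closed[OF subM] by (metis inj_onD)
    then have "card (M (Suc j)) \<noteq> card (M j)"
      unfolding M_Suc using finM eq_card_imp_inj_on by blast
    moreover have "card (M (Suc j)) \<le> card (M j)"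
      unfolding M_Suc by (rule card_image_le[OF finM])
    ultimately show ?thesis by simp
  qed
  have "j \<le> n \<Longrightarrow> card (M j) \<le> p ^ (n - j)" for j
  proof (induction j)
    case 0
    then show ?case using ord by (simp add: M_def order_def)
  next
    case (Suc j)
    show ?case
    proof (cases "M j = {\<one>}")
      case True
      then have "card (M (Suc j)) \<le> 1"
        using M_sub[of j] by (metis card.empty card_insert_disjoint card_mono empty_iff finM finite.emptyI One_nat_def)
      also have "1 \<le> p ^ (n - Suc j)" using p by (simp add: prime_gt_0_nat Suc_leI)
      finally show ?thesis .
    next
      case False
      have dv: "card (M (Suc j)) dvd p ^ n"
        by (metis ord lagrange[OF subM] dvd_triv_right)
      then obtain f where f: "card (M (Suc j)) = p ^ f"
        using p divides_primepow_nat by auto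
      have "p ^ f < p ^ (n - j)"
        using shrink[OF False] Suc f by simp
      then have "f < n - j" using p prime_gt_1_nat by (metis power_less_imp_less_exp)
      then have "p ^ f \<le> p ^ (n - Suc j)"
        using p by (intro power_increasing) (auto simp: prime_gt_0_nat Suc_leI)
      then show ?thesis using f by simp
    qed
  qed
  from this[of n] have "card (M n) \<le> 1" by simp
  moreover have "\<one> \<in> M n" "(D ^^ n) y \<in> M n"
    using subgroup.one_closed[OF subM] y by (auto simp: M_def)
  ultimately show ?thesis
    using finM card_le_Suc0_iff_eq by (metis One_nat_def)
qed

text \<open>
  For an endomorphism \<open>\<phi>\<close> of an abelian group this is the operator \<open>\<phi> - 1\<close>.
\<close>

definition displacement :: "('a, 'b) monoid_scheme \<Rightarrow> ('a \<Rightarrow> 'a) \<Rightarrow> 'a \<Rightarrow> 'a"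
  where "displacement G \<phi> y = inv\<^bsub>G\<^esub> y \<otimes>\<^bsub>G\<^esub> \<phi> y"

lemma (in comm_group) displacement_hom:
  assumes "\<phi> \<in> hom G G"
  shows "displacement G \<phi> \<in> hom G G"
  using assms by (auto simp: hom_def displacement_def Pi_def inv_mult m_ac)

text \<open>
  The recursion that \<open>newton_forward_difference\<close> asks for, for the table \<open>D\<^sup>j \<phi>\<^sup>i y\<close>: it is
  \<open>\<phi> = 1 + D\<close> pushed through \<open>D\<^sup>j\<close>.
\<close>

lemma (in comm_group) displacement_funpow_step:
  assumes \<phi>: "\<phi> \<in> hom G G" and y: "y \<in> carrier G"
  shows "(displacement G \<phi> ^^ j) ((\<phi> ^^ Suc i) y)
       = (displacement G \<phi> ^^ j) ((\<phi> ^^ i) y) \<otimes> (displacement G \<phi> ^^ Suc j) ((\<phi> ^^ i) y)"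
proof -
  let ?D = "displacement G \<phi>" and ?z = "(\<phi> ^^ i) y"
  have z: "?z \<in> carrier G"
    using hom_funpow[OF \<phi>] y by (auto simp: hom_def)
  have cl: "\<phi> ?z \<in> carrier G" "?D ?z \<in> carrier G"
    using z \<phi> displacement_hom[OF \<phi>] by (auto simp: hom_def)
  have "\<phi> ?z = ?z \<otimes> ?D ?z"
    using z cl by (simp add: displacement_def flip: m_assoc)
  then have "(?D ^^ j) (\<phi> ?z) = (?D ^^ j) ?z \<otimes> (?D ^^ j) (?D ?z)"
    using hom_mult[OF hom_funpow[OF displacement_hom[OF \<phi>]] z cl(2)] by simp
  then show ?thesis
    by (simp add: funpow_swap1)
qed

text \<open>
  On an element \<open>y\<close> killed by \<open>p\<close>, Newton's formula for \<open>q = p\<^sup>a\<close> reads \<open>\<phi>\<^sup>q y = y + D\<^sup>q y\<close> because the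
  intermediate binomial coefficients are multiples of \<open>p\<close>. So \<open>\<phi>\<^sup>q = 1\<close> forces \<open>D\<^sup>q y = 0\<close>, which is the
  hypothesis of \<open>hom_nilpotent\<close>.
\<close>

lemma (in comm_group) displacement_nilpotent:
  assumes p: "Factorial_Ring.prime p" and ord: "order G = p ^ n"
    and \<phi>: "\<phi> \<in> hom G G" and per: "\<And>y. y \<in> carrier G \<Longrightarrow> (\<phi> ^^ (p ^ a)) y = y"
    and y: "y \<in> carrier G"
  shows "(displacement G \<phi> ^^ n) y = \<one>"
proof (rule hom_nilpotent[OF p ord displacement_hom[OF \<phi>] _ y])
  fix y assume y: "y \<in> carrier G" and yp: "y [^] p = \<one>"
  let ?D = "displacement G \<phi>"
  have Dh: "?D ^^ j \<in> hom G G" for j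
    by (rule hom_funpow[OF displacement_hom[OF \<phi>]])
  have cl: "(?D ^^ j) ((\<phi> ^^ i) y) \<in> carrier G" for i j
    using Dh hom_funpow[OF \<phi>] y by (auto simp: hom_def Pi_def)
  obtain r where r: "p ^ a = Suc r"
    using p by (metis not0_implies_Suc not_prime_0 power_not_zero)
  have pw: "(?D ^^ j) y [^] (p ^ a choose j) = \<one>" if "0 < j" "j < p ^ a" for j
  proof -
    have "p dvd (p ^ a choose j)"
      by (rule prime_dvd_prime_power_binomial[OF p that])
    then obtain b where b: "(p ^ a choose j) = p * b" ..
    have "(?D ^^ j) y [^] p = \<one>"
      using hom_nat_pow[OF Dh y is_group is_group, of j p] yp hom_one[OF Dh is_group is_group]
      by simp
    then show ?thesis
      unfolding b using cl[of j 0] by (simp flip: nat_pow_pow)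
  qed
  have "y = (\<phi> ^^ (p ^ a)) y" using per y by simp
  also have "\<dots> = (\<Otimes>j\<in>{..p ^ a}. (?D ^^ j) y [^] (p ^ a choose j))"
    using newton_forward_difference[of "\<lambda>j i. (?D ^^ j) ((\<phi> ^^ i) y)" "p ^ a"]
      cl displacement_funpow_step[OF \<phi> y] by simp
  also have "\<dots> = (?D ^^ (p ^ a)) y \<otimes> (\<Otimes>j\<in>{..r}. (?D ^^ j) y [^] (p ^ a choose j))"
    using cl[of _ 0] cl[of "Suc r" 0] unfolding r by (subst finprod_Suc) auto
  also have "(\<Otimes>j\<in>{..r}. (?D ^^ j) y [^] (p ^ a choose j)) = y"
  proof (cases r)
    case 0
    then show ?thesis using y by simp
  next
    case s: (Suc s)
    have "(\<Otimes>j\<in>{..r}. (?D ^^ j) y [^] (p ^ a choose j))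
      = (\<Otimes>j\<in>{..s}. (?D ^^ Suc j) y [^] (p ^ a choose Suc j)) \<otimes> y"
      using cl[of _ 0] y unfolding s by (subst finprod_Suc2) auto
    also have "(\<Otimes>j\<in>{..s}. (?D ^^ Suc j) y [^] (p ^ a choose Suc j)) = (\<Otimes>j\<in>{..s}. \<one>)"
      by (rule finprod_cong') (use pw r s in \<open>auto simp del: funpow.simps binomial_Suc_Suc\<close>)
    finally show ?thesis using y by simp
  qed
  finally show "(?D ^^ (p ^ a)) y = \<one>"
    using y cl[of "p ^ a" 0] by simp
qed

text \<open>
  This is where \<open>n < p\<close> enters. With \<open>q = p\<^sup>k\<close> and in additive notation,
  \<open>f\<^sup>q 0 = \<Sum>\<^sub>j (q choose j+1) D\<^sup>j x\<close>. The terms with \<open>j \<ge> n\<close> vanish, and in the others \<open>j + 1 \<le> n < p\<close>,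
  so that the coefficient is \<open>q b\<^sub>j\<close> with \<open>b\<^sub>0 = 1\<close>. The sum is therefore
  \<open>\<Sum>\<^sub>j b\<^sub>j D\<^sup>j (q x)\<close>, which vanishes exactly if \<open>q x\<close> does.
\<close>

lemma (in comm_group) affine_prime_power_fixes_one_iff:
  assumes p: "Factorial_Ring.prime p" and ord: "order G = p ^ n" and "n < p"
    and \<phi>: "\<phi> \<in> hom G G" and x: "x \<in> carrier G"
    and f: "\<And>y. y \<in> carrier G \<Longrightarrow> f y = x \<otimes> \<phi> y"
    and per: "\<And>y. y \<in> carrier G \<Longrightarrow> (f ^^ (p ^ a)) y = y"
  shows "(f ^^ (p ^ k)) \<one> = \<one> \<longleftrightarrow> x [^] (p ^ k) = \<one>"
proof -
  let ?D = "displacement G \<phi>"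
  have \<phi>i: "\<phi> ^^ i \<in> hom G G" for i by (rule hom_funpow[OF \<phi>])
  have \<phi>c: "(\<phi> ^^ i) y \<in> carrier G" if "y \<in> carrier G" for i y
    using \<phi>i that by (auto simp: hom_def Pi_def)
  have fc: "f y \<in> carrier G" if "y \<in> carrier G" for y
    using that f x \<phi>c[of y 1] by simp
  have fic: "(f ^^ i) y \<in> carrier G" if "y \<in> carrier G" for i y
    using that by (induction i) (auto simp: fc)
  have f_iter: "(f ^^ i) y = (f ^^ i) \<one> \<otimes> (\<phi> ^^ i) y" if y: "y \<in> carrier G" for i y
  proof (induction i)
    case (Suc i)
    have "f ((f ^^ i) \<one> \<otimes> (\<phi> ^^ i) y) = x \<otimes> (\<phi> ((f ^^ i) \<one>) \<otimes> \<phi> ((\<phi> ^^ i) y))"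
      using f fic \<phi>c y by (simp add: hom_mult[OF \<phi>])
    also have "\<dots> = f ((f ^^ i) \<one>) \<otimes> \<phi> ((\<phi> ^^ i) y)"
      using f fic[of \<one> i] \<phi>c[of _ 1] \<phi>c[OF y, of i] x by (simp add: m_assoc)
    finally show ?case using Suc by simp
  qed (use y in simp)
  have \<phi>_per: "(\<phi> ^^ (p ^ a)) y = y" if "y \<in> carrier G" for y
    using f_iter[OF that, of "p ^ a"] per that \<phi>c[OF that] by simp
  have nil: "(?D ^^ n) y = \<one>" if "y \<in> carrier G" for y
    by (rule displacement_nilpotent[OF p ord \<phi> \<phi>_per that])
  have Dh: "?D ^^ j \<in> hom G G" for j
    by (rule hom_funpow[OF displacement_hom[OF \<phi>]])
  have Dc: "(?D ^^ j) y \<in> carrier G" if "y \<in> carrier G" for j y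
    using Dh that by (auto simp: hom_def Pi_def)
  have D1: "(?D ^^ j) \<one> = \<one>" for j
    using hom_one[OF Dh] by simp
  have nil': "(?D ^^ j) y = \<one>" if "y \<in> carrier G" "n \<le> j" for y j
    using nil[OF that(1)] D1 that(2) by (metis comp_apply funpow_add le_add_diff_inverse2)
  \<comment> \<open>The difference table of the orbit \<open>f\<^sup>i 1\<close>: its first differences are \<open>\<phi>\<^sup>i x\<close>, and from
    there on differencing means applying \<open>D\<close>.\<close>
  define c where "c j i = (case j of 0 \<Rightarrow> (f ^^ i) \<one> | Suc j' \<Rightarrow> (?D ^^ j') ((\<phi> ^^ i) x))" for j i
  have cc: "c j i \<in> carrier G" for j i
    by (auto simp: c_def fic Dc \<phi>c x split: nat.split)
  have cs: "c j (Suc i) = c j i \<otimes> c (Suc j) i" for j i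
  proof (cases j)
    case 0
    have "(f ^^ Suc i) \<one> = (f ^^ i) (f \<one>)" by (simp add: funpow_swap1)
    also have "f \<one> = x" using f[of \<one>] hom_one[OF \<phi>] x by simp
    finally show ?thesis using f_iter[OF x, of i] 0 by (simp add: c_def)
  next
    case (Suc j')
    show ?thesis
      using displacement_funpow_step[OF \<phi> x, of j' i] unfolding Suc c_def by simp
  qed
  obtain r where r: "p ^ k = Suc r"
    using p by (metis not0_implies_Suc not_prime_0 power_not_zero)
  define b where "b j = (p ^ k choose Suc j) div p ^ k" for j
  define z where "z = x [^] (p ^ k)"
  have zc: "z \<in> carrier G" using x by (simp add: z_def)
  have term_eq: "(?D ^^ j) x [^] (p ^ k choose Suc j) = (?D ^^ j) z [^] b j" for j
  proof (cases "j < n")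
    case True
    then have "p ^ k dvd (p ^ k choose Suc j)"
      using \<open>n < p\<close> by (intro prime_power_dvd_binomial[OF p]) auto
    then have "(p ^ k choose Suc j) = p ^ k * b j" by (simp add: b_def)
    then show ?thesis
      using hom_nat_pow[OF Dh x is_group is_group, of j "p ^ k"] Dc[OF x]
      by (simp add: z_def nat_pow_pow)
  next
    case False
    then show ?thesis using nil' x zc by simp
  qed
  have "(f ^^ (p ^ k)) \<one> = (\<Otimes>j\<in>{..p ^ k}. c j 0 [^] (p ^ k choose j))"
    using newton_forward_difference[of c, OF cc cs, of "p ^ k"] by (simp add: c_def)
  also have "\<dots> = (\<Otimes>j\<in>{..r}. c (Suc j) 0 [^] (p ^ k choose Suc j)) \<otimes> c 0 0"
    using cc unfolding r by (subst finprod_Suc2) auto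
  also have "\<dots> = (\<Otimes>j\<in>{..r}. (?D ^^ j) z [^] b j)"
    by (simp add: c_def term_eq finprod_closed Dc zc)
  finally have eq: "(f ^^ (p ^ k)) \<one> = (\<Otimes>j\<in>{..r}. (?D ^^ j) z [^] b j)" .
  have b0: "b 0 = 1" using r by (simp add: b_def)
  show ?thesis
  proof
    assume "(f ^^ (p ^ k)) \<one> = \<one>"
    then show "x [^] (p ^ k) = \<one>"
      using nilpotent_combination_eq_one[of ?D z n b r] displacement_hom[OF \<phi>] zc nil b0 eq
      by (simp add: z_def)
  next
    assume "x [^] (p ^ k) = \<one>"
    then show "(f ^^ (p ^ k)) \<one> = \<one>"
      unfolding eq z_def by (simp add: D1)
  qed
qed

section \<open>Counting torsion elements\<close>

definition torsion :: "('a, 'b) monoid_scheme \<Rightarrow> nat \<Rightarrow> 'a set"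
  where "torsion G m = {x \<in> carrier G. x [^]\<^bsub>G\<^esub> m = \<one>\<^bsub>G\<^esub>}"

lemma card_torsion_iso:
  assumes "G \<cong> H" "group G" "group H"
  shows "card (torsion G m) = card (torsion H m)"
proof -
  obtain h where h: "h \<in> hom G H" "bij_betw h (carrier G) (carrier H)"
    using assms(1) by (auto simp: is_iso_def iso_def)
  interpret group_hom G H h
    using assms h by (simp add: group_hom_def group_hom_axioms_def)
  have eq: "h x [^]\<^bsub>H\<^esub> m = \<one>\<^bsub>H\<^esub> \<longleftrightarrow> x [^]\<^bsub>G\<^esub> m = \<one>\<^bsub>G\<^esub>" if "x \<in> carrier G" for x
    using that h(2) hom_nat_pow[OF that, of m]
    by (metis G.nat_pow_closed G.one_closed bij_betw_imp_inj_on hom_one inj_onD)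
  have "h ` torsion G m = torsion H m"
    using h(2) eq by (auto simp: torsion_def bij_betw_def image_iff) (metis imageE)
  moreover have "inj_on h (torsion G m)"
    using h(2) by (auto simp: torsion_def bij_betw_def inj_on_def)
  ultimately show ?thesis
    by (metis card_image)
qed

lemma pow_DirProd:
  "x [^]\<^bsub>G \<times>\<times> H\<^esub> (m::nat) = (fst x [^]\<^bsub>G\<^esub> m, snd x [^]\<^bsub>H\<^esub> m)"
  by (induction m) (simp_all add: DirProd_def split_beta)

lemma card_torsion_DirProd:
  "card (torsion (G \<times>\<times> H) m) = card (torsion G m) * card (torsion H m)"
proof -
  have "torsion (G \<times>\<times> H) m = torsion G m \<times> torsion H m"
    by (auto simp: torsion_def pow_DirProd)
  then show ?thesis by (simp add: card_cartesian_product)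
qed

lemma (in group) card_torsion_pos:
  assumes "finite (carrier G)"
  shows "0 < card (torsion G m)"
proof -
  have "\<one> \<in> torsion G m" "finite (torsion G m)" using assms by (auto simp: torsion_def)
  then show ?thesis by (auto simp: card_gt_0_iff)
qed

lemma (in group) card_torsion_eq_order_iff:
  assumes "finite (carrier G)"
  shows "card (torsion G m) = order G \<longleftrightarrow> (\<forall>y\<in>carrier G. y [^] m = \<one>)"
proof -
  have "torsion G m \<subseteq> carrier G" by (auto simp: torsion_def)
  then have "card (torsion G m) = order G \<longleftrightarrow> torsion G m = carrier G"
    using assms by (metis card_subset_eq order_def)
  then show ?thesis by (auto simp: torsion_def)
qed

section \<open>Holomorphs and Sylow subgroups\<close>

text \<open>
  If \<open>h\<close> normalizes the left translations, then \<open>h\<close> after translation by \<open>x\<close> is translation by some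
  \<open>x'\<close> after \<open>h\<close>. Evaluating at the identity gives \<open>x' = h(x) h(1)\<^sup>-\<^sup>1\<close>, which says that
  \<open>y \<mapsto> h(1)\<^sup>-\<^sup>1 h(y)\<close> is multiplicative.
\<close>

lemma holomorph_affine:
  assumes "group N" and h: "h \<in> carrier (holomorph N)"
  obtains \<phi> where "\<phi> \<in> hom N N"
    and "\<And>y. y \<in> carrier N \<Longrightarrow> h y = h \<one>\<^bsub>N\<^esub> \<otimes>\<^bsub>N\<^esub> \<phi> y"
proof -
  interpret N: group N by fact
  let ?B = "BijGroup (carrier N)"
  let ?L = "left_regular N ` carrier N"
  interpret B: group ?B by (rule group_BijGroup)
  have L: "?L \<subseteq> carrier ?B"
    using left_regular_in_Bij[OF assms(1)] by (auto simp: BijGroup_def)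
  have hB: "h \<in> carrier ?B" and norm: "h <#\<^bsub>?B\<^esub> ?L #>\<^bsub>?B\<^esub> inv\<^bsub>?B\<^esub> h = ?L"
    using h L by (simp_all add: holomorph_def normalizer_def stabilizer_def)
  have hBij: "h \<in> Bij (carrier N)" using hB by (simp add: BijGroup_def)
  then have hc: "h y \<in> carrier N" if "y \<in> carrier N" for y
    using that Bij_imp_funcset by blast
  have translate: "\<exists>x'\<in>carrier N. \<forall>y\<in>carrier N. h (x \<otimes>\<^bsub>N\<^esub> y) = x' \<otimes>\<^bsub>N\<^esub> h y"
    if x: "x \<in> carrier N" for x
  proof -
    let ?l = "left_regular N"
    have lB: "?l x \<in> carrier ?B" using L x by blast
    have "h \<otimes>\<^bsub>?B\<^esub> ?l x \<otimes>\<^bsub>?B\<^esub> inv\<^bsub>?B\<^esub> h \<in> h <#\<^bsub>?B\<^esub> ?L #>\<^bsub>?B\<^esub> inv\<^bsub>?B\<^esub> h"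
      using x by (auto simp: l_coset_def r_coset_def)
    then obtain x' where x': "x' \<in> carrier N"
      and "h \<otimes>\<^bsub>?B\<^esub> ?l x \<otimes>\<^bsub>?B\<^esub> inv\<^bsub>?B\<^esub> h = ?l x'"
      unfolding norm by blast
    then have "?l x' \<otimes>\<^bsub>?B\<^esub> h = h \<otimes>\<^bsub>?B\<^esub> ?l x \<otimes>\<^bsub>?B\<^esub> inv\<^bsub>?B\<^esub> h \<otimes>\<^bsub>?B\<^esub> h"
      by simp
    also have "\<dots> = h \<otimes>\<^bsub>?B\<^esub> ?l x"
      using hB lB by (simp add: B.m_assoc)
    finally have eq: "compose (carrier N) (?l x') h = compose (carrier N) h (?l x)"
      using hBij left_regular_in_Bij[OF assms(1)] x x' by (simp add: BijGroup_def)
    have "h (x \<otimes>\<^bsub>N\<^esub> y) = x' \<otimes>\<^bsub>N\<^esub> h y" if "y \<in> carrier N" for y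
      using fun_cong[OF eq, of y] that hc by (simp add: compose_def left_regular_def)
    with x' show ?thesis by blast
  qed
  define \<phi> where "\<phi> y = inv\<^bsub>N\<^esub> (h \<one>\<^bsub>N\<^esub>) \<otimes>\<^bsub>N\<^esub> h y" for y
  have "\<phi> \<in> hom N N"
  proof (rule homI)
    fix x y assume x: "x \<in> carrier N" and y: "y \<in> carrier N"
    show "\<phi> x \<in> carrier N" using x hc by (simp add: \<phi>_def)
    obtain x' where x': "x' \<in> carrier N"
      and tr: "\<And>y. y \<in> carrier N \<Longrightarrow> h (x \<otimes>\<^bsub>N\<^esub> y) = x' \<otimes>\<^bsub>N\<^esub> h y"
      using translate[OF x] by blast
    have "h x = x' \<otimes>\<^bsub>N\<^esub> h \<one>\<^bsub>N\<^esub>" using tr[OF N.one_closed] x by simp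
    moreover have "h \<one>\<^bsub>N\<^esub> \<otimes>\<^bsub>N\<^esub> (inv\<^bsub>N\<^esub> h \<one>\<^bsub>N\<^esub> \<otimes>\<^bsub>N\<^esub> h y) = h y"
      using hc y by (simp flip: N.m_assoc)
    ultimately show "\<phi> (x \<otimes>\<^bsub>N\<^esub> y) = \<phi> x \<otimes>\<^bsub>N\<^esub> \<phi> y"
      using x' hc x y tr[OF y] unfolding \<phi>_def by (simp add: N.m_assoc)
  qed
  moreover have "h y = h \<one>\<^bsub>N\<^esub> \<otimes>\<^bsub>N\<^esub> \<phi> y" if "y \<in> carrier N" for y
    using hc that by (simp add: \<phi>_def flip: N.m_assoc)
  ultimately show thesis using that by blast
qed

text \<open>
  From here on a realization matters only as an affine action on \<open>N\<close> in which \<open>G'\<close> is the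
  stabilizer of the identity.
\<close>

lemma realizable_imp_affine_action:
  fixes G :: "('g, 'c) monoid_scheme" and N :: "('a, 'b) monoid_scheme"
  assumes "realizable G G' N"
  obtains \<alpha> :: "'g \<Rightarrow> 'a \<Rightarrow> 'a"
  where "\<And>y. y \<in> carrier N \<Longrightarrow> \<alpha> \<one>\<^bsub>G\<^esub> y = y"
    and "\<And>g h y. \<lbrakk>g \<in> carrier G; h \<in> carrier G; y \<in> carrier N\<rbrakk> \<Longrightarrow> \<alpha> (g \<otimes>\<^bsub>G\<^esub> h) y = \<alpha> g (\<alpha> h y)"
    and "\<And>g y. \<lbrakk>g \<in> carrier G; y \<in> carrier N\<rbrakk> \<Longrightarrow> \<alpha> g y \<in> carrier N"
    and "\<And>g. g \<in> carrier G \<Longrightarrow> \<exists>\<phi>\<in>hom N N. \<forall>y\<in>carrier N. \<alpha> g y = \<alpha> g \<one>\<^bsub>N\<^esub> \<otimes>\<^bsub>N\<^esub> \<phi> y"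
    and "\<And>g. g \<in> carrier G \<Longrightarrow> g \<in> G' \<longleftrightarrow> \<alpha> g \<one>\<^bsub>N\<^esub> = \<one>\<^bsub>N\<^esub>"
proof -
  from assms obtain \<beta> where G: "group G" and G': "subgroup G' G" and N: "group N"
    and \<beta>: "\<beta> \<in> hom G (holomorph N)" "inj_on \<beta> (carrier G)"
    and st: "\<beta> ` G' = stabilizer ((holomorph N)\<lparr>carrier := \<beta> ` carrier G\<rparr>) (\<lambda>f. f) \<one>\<^bsub>N\<^esub>"
    by (auto simp: realizable_def mon_def)
  have hol: "\<beta> g \<in> carrier (holomorph N)" if "g \<in> carrier G" for g
    using \<beta>(1) that by (auto simp: hom_def)
  have "carrier (holomorph N) \<subseteq> Bij (carrier N)"
    by (auto simp: holomorph_def normalizer_def stabilizer_def BijGroup_def)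
  with hol have bij: "\<beta> g \<in> Bij (carrier N)" if "g \<in> carrier G" for g
    using that by blast
  show thesis
  proof (rule that[of \<beta>])
    fix y assume y: "y \<in> carrier N"
    have "\<beta> \<one>\<^bsub>G\<^esub> = \<one>\<^bsub>holomorph N\<^esub>"
      by (rule hom_one[OF \<beta>(1) G group_holomorph[OF N]])
    then show "\<beta> \<one>\<^bsub>G\<^esub> y = y"
      using y by (simp add: holomorph_def BijGroup_def)
    fix g assume g: "g \<in> carrier G"
    show "\<beta> g y \<in> carrier N"
      using bij[OF g] y Bij_imp_funcset by blast
    fix h assume h: "h \<in> carrier G"
    have "\<beta> (g \<otimes>\<^bsub>G\<^esub> h) = \<beta> g \<otimes>\<^bsub>holomorph N\<^esub> \<beta> h"
      by (rule hom_mult[OF \<beta>(1) g h])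
    then show "\<beta> (g \<otimes>\<^bsub>G\<^esub> h) y = \<beta> g (\<beta> h y)"
      using bij[OF g] bij[OF h] y by (simp add: holomorph_def BijGroup_def compose_def)
  next
    fix g assume g: "g \<in> carrier G"
    show "\<exists>\<phi>\<in>hom N N. \<forall>y\<in>carrier N. \<beta> g y = \<beta> g \<one>\<^bsub>N\<^esub> \<otimes>\<^bsub>N\<^esub> \<phi> y"
      using holomorph_affine[OF N hol[OF g]] by metis
    have "g \<in> G' \<longleftrightarrow> \<beta> g \<in> \<beta> ` G'"
      using \<beta>(2) g subgroup.subset[OF G'] by (simp add: inj_on_image_mem_iff)
    also have "\<dots> \<longleftrightarrow> \<beta> g \<one>\<^bsub>N\<^esub> = \<one>\<^bsub>N\<^esub>"
      using g by (simp add: st stabilizer_def)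
    finally show "g \<in> G' \<longleftrightarrow> \<beta> g \<one>\<^bsub>N\<^esub> = \<one>\<^bsub>N\<^esub>" .
  qed
qed

lemma card_preimage_equal_fibres:
  assumes "finite P" "A \<subseteq> f ` P"
    and "\<And>y. y \<in> f ` P \<Longrightarrow> card {g \<in> P. f g = y} = c"
  shows "card {g \<in> P. f g \<in> A} = card A * c"
proof -
  have finA: "finite A" using assms(1,2) finite_surj by blast
  have "{g \<in> P. f g \<in> A} = (\<Union>y\<in>A. {g \<in> P. f g = y})" by auto
  also have "card \<dots> = (\<Sum>y\<in>A. card {g \<in> P. f g = y})"
    using assms(1) finA by (intro card_UN_disjoint) auto
  also have "\<dots> = (\<Sum>y\<in>A. c)"
    using assms(2,3) by (intro sum.cong) auto
  finally show ?thesis by simp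
qed

text \<open>
  The map \<open>ev\<close> that sends \<open>g\<close> to the image of the identity of \<open>N\<close> has the left cosets of \<open>G'\<close> as
  fibres, so on \<open>P\<close> its nonempty fibres all have \<open>|P \<inter> G'|\<close> elements. It is onto even on \<open>P\<close>:
  \<open>|P \<inter> G'|\<close> divides \<open>|G'|\<close>, whose \<open>p\<close>-part is \<open>|P| / p\<^sup>n\<close>, so the image of \<open>P\<close> has at least
  \<open>p\<^sup>n = |N|\<close> elements. It remains to translate \<open>g^(p\<^sup>k) \<in> G'\<close> into a condition on \<open>ev g\<close>, by
  \<open>affine_prime_power_fixes_one_iff\<close>.
\<close>

lemma card_prime_power_roots_of_stabilizer:
  assumes p: "Factorial_Ring.prime p" and "n < p"
    and N: "comm_group N" and ordN: "order N = p ^ n"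
    and real: "realizable G G' N"
    and P: "subgroup P G" and cardP: "card P = p ^ a"
    and ordG: "order G = p ^ a * m" and m: "\<not> p dvd m"
  shows "card {g \<in> P. g [^]\<^bsub>G\<^esub> (p ^ k) \<in> G'} = card (P \<inter> G') * card (torsion N (p ^ k))"
proof -
  interpret N: comm_group N by fact
  interpret G: group G using real by (simp add: realizable_def)
  have G': "subgroup G' G" and finG: "finite (carrier G)"
    and index: "card (rcosets\<^bsub>G\<^esub> G') = p ^ n"
    using real ordN by (simp_all add: realizable_def)
  obtain \<alpha> where \<alpha>1: "\<And>y. y \<in> carrier N \<Longrightarrow> \<alpha> \<one>\<^bsub>G\<^esub> y = y"
    and \<alpha>m: "\<And>g h y. \<lbrakk>g \<in> carrier G; h \<in> carrier G; y \<in> carrier N\<rbrakk>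
        \<Longrightarrow> \<alpha> (g \<otimes>\<^bsub>G\<^esub> h) y = \<alpha> g (\<alpha> h y)"
    and \<alpha>c: "\<And>g y. \<lbrakk>g \<in> carrier G; y \<in> carrier N\<rbrakk> \<Longrightarrow> \<alpha> g y \<in> carrier N"
    and aff: "\<And>g. g \<in> carrier G
        \<Longrightarrow> \<exists>\<phi>\<in>hom N N. \<forall>y\<in>carrier N. \<alpha> g y = \<alpha> g \<one>\<^bsub>N\<^esub> \<otimes>\<^bsub>N\<^esub> \<phi> y"
    and stab: "\<And>g. g \<in> carrier G \<Longrightarrow> g \<in> G' \<longleftrightarrow> \<alpha> g \<one>\<^bsub>N\<^esub> = \<one>\<^bsub>N\<^esub>"
    by (rule realizable_imp_affine_action[OF real]) blast
  define ev where "ev g = \<alpha> g \<one>\<^bsub>N\<^esub>" for g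
  have Pc: "g \<in> carrier G" if "g \<in> P" for g
    using P that subgroup.mem_carrier by metis
  have finP: "finite P" by (rule finite_subset[OF subgroup.subset[OF P] finG])
  have finN: "finite (carrier N)"
    using ordN p by (metis N.order_gt_0_iff_finite prime_gt_0_nat zero_less_power)
  have ev_eq: "ev g = ev h \<longleftrightarrow> inv\<^bsub>G\<^esub> h \<otimes>\<^bsub>G\<^esub> g \<in> G'"
    if g: "g \<in> carrier G" and h: "h \<in> carrier G" for g h
  proof
    assume "ev g = ev h"
    then have "\<alpha> (inv\<^bsub>G\<^esub> h \<otimes>\<^bsub>G\<^esub> g) \<one>\<^bsub>N\<^esub> = \<alpha> (inv\<^bsub>G\<^esub> h \<otimes>\<^bsub>G\<^esub> h) \<one>\<^bsub>N\<^esub>"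
      by (simp only: ev_def \<alpha>m[OF G.inv_closed[OF h] _ N.one_closed] g h)
    then show "inv\<^bsub>G\<^esub> h \<otimes>\<^bsub>G\<^esub> g \<in> G'" using g h by (simp add: stab \<alpha>1)
  next
    assume "inv\<^bsub>G\<^esub> h \<otimes>\<^bsub>G\<^esub> g \<in> G'"
    then have "\<alpha> h (\<alpha> (inv\<^bsub>G\<^esub> h \<otimes>\<^bsub>G\<^esub> g) \<one>\<^bsub>N\<^esub>) = ev h"
      using g h by (simp add: stab ev_def)
    then have "\<alpha> (h \<otimes>\<^bsub>G\<^esub> (inv\<^bsub>G\<^esub> h \<otimes>\<^bsub>G\<^esub> g)) \<one>\<^bsub>N\<^esub> = ev h"
      using g h by (simp add: \<alpha>m)
    then show "ev g = ev h"
      using g h by (simp add: ev_def flip: G.m_assoc)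
  qed
  have fibre: "card {g \<in> P. ev g = y} = card (P \<inter> G')" if "y \<in> ev ` P" for y
  proof -
    from that obtain h where h: "h \<in> P" "y = ev h" by blast
    have "{g \<in> P. ev g = y} = (\<lambda>q. h \<otimes>\<^bsub>G\<^esub> q) ` (P \<inter> G')"
    proof (intro equalityI subsetI)
      fix g assume "g \<in> {g \<in> P. ev g = y}"
      then have g: "g \<in> P" and "inv\<^bsub>G\<^esub> h \<otimes>\<^bsub>G\<^esub> g \<in> G'"
        using h Pc ev_eq by auto
      moreover have "inv\<^bsub>G\<^esub> h \<otimes>\<^bsub>G\<^esub> g \<in> P"
        using P g h by (simp add: subgroup.m_closed subgroup.m_inv_closed)
      moreover have "g = h \<otimes>\<^bsub>G\<^esub> (inv\<^bsub>G\<^esub> h \<otimes>\<^bsub>G\<^esub> g)"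
        using Pc g h by (simp flip: G.m_assoc)
      ultimately show "g \<in> (\<lambda>q. h \<otimes>\<^bsub>G\<^esub> q) ` (P \<inter> G')" by blast
    next
      fix g assume "g \<in> (\<lambda>q. h \<otimes>\<^bsub>G\<^esub> q) ` (P \<inter> G')"
      then obtain q where q: "q \<in> P" "q \<in> G'" "g = h \<otimes>\<^bsub>G\<^esub> q" by blast
      have "inv\<^bsub>G\<^esub> h \<otimes>\<^bsub>G\<^esub> g = q"
        using Pc q h by (simp flip: G.m_assoc)
      moreover have "g \<in> P" using P q h by (simp add: subgroup.m_closed)
      ultimately show "g \<in> {g \<in> P. ev g = y}"
        using ev_eq[of g h] Pc h q by simp
    qed
    moreover have "inj_on (\<lambda>q. h \<otimes>\<^bsub>G\<^esub> q) (P \<inter> G')"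
      using Pc h by (auto simp: inj_on_def)
    ultimately show ?thesis by (simp add: card_image)
  qed
  have evP: "ev ` P \<subseteq> carrier N"
    using Pc \<alpha>c by (auto simp: ev_def)
  have surj: "ev ` P = carrier N"
  proof -
    have PG': "subgroup (P \<inter> G') G" by (rule G.subgroups_Inter_pair[OF P G'])
    have "card (P \<inter> G') dvd card G'"
      using group.lagrange[OF G.subgroup_imp_group[OF G'] G.subgroup_incl[OF PG' G' inf_le2]]
      by (simp add: order_def) (metis dvd_triv_right)
    have count: "p ^ a = card (ev ` P) * card (P \<inter> G')"
    proof -
      have "{g \<in> P. ev g \<in> ev ` P} = P" by auto
      then show ?thesis
        using card_preimage_equal_fibres[OF finP subset_refl fibre] cardP by simp
    qed
    then have "card (P \<inter> G') dvd p ^ a" by simp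
    then obtain b where b: "card (P \<inter> G') = p ^ b" using p divides_primepow_nat by auto
    have "p ^ n * card G' = p ^ a * m"
      using G.lagrange[OF G'] index ordG by simp
    then have "p ^ n * p ^ b dvd p ^ a * m"
      using \<open>card (P \<inter> G') dvd card G'\<close> b by (metis dvd_refl mult_dvd_mono)
    moreover have "coprime (p ^ n * p ^ b) m"
      using p m by (simp add: prime_imp_coprime)
    ultimately have "p ^ n * p ^ b dvd card (ev ` P) * p ^ b"
      using count b by (simp add: coprime_dvd_mult_left_iff)
    then have "p ^ n dvd card (ev ` P)"
      using p by (simp add: prime_gt_0_nat)
    moreover have "card (ev ` P) \<noteq> 0"
      using count p by (metis mult_is_0 not_prime_0 power_not_zero)
    ultimately have "p ^ n \<le> card (ev ` P)" by (simp add: dvd_imp_le)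
    then show ?thesis
      using card_seteq[OF finN evP] ordN by (simp add: order_def)
  qed
  have power: "\<alpha> (g [^]\<^bsub>G\<^esub> i) y = (\<alpha> g ^^ i) y" if g: "g \<in> carrier G" and y: "y \<in> carrier N" for g i y
  proof (induction i)
    case (Suc i)
    have "\<alpha> (g [^]\<^bsub>G\<^esub> Suc i) y = \<alpha> (g \<otimes>\<^bsub>G\<^esub> g [^]\<^bsub>G\<^esub> i) y"
      using g by (metis G.nat_pow_Suc2)
    then show ?case using Suc g y by (simp add: \<alpha>m)
  qed (use y \<alpha>1 in simp)
  have "g [^]\<^bsub>G\<^esub> (p ^ k) \<in> G' \<longleftrightarrow> ev g \<in> torsion N (p ^ k)" if g: "g \<in> P" for g
  proof -
    have gc: "g \<in> carrier G" using Pc g .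
    obtain \<phi> where \<phi>: "\<phi> \<in> hom N N"
      and af: "\<And>y. y \<in> carrier N \<Longrightarrow> \<alpha> g y = ev g \<otimes>\<^bsub>N\<^esub> \<phi> y"
      using aff[OF gc] by (auto simp: ev_def)
    have "g [^]\<^bsub>G\<^esub> (p ^ a) = \<one>\<^bsub>G\<^esub>"
      using group.pow_order_eq_1[OF G.subgroup_imp_group[OF P], of g] g cardP
      by (simp add: order_def flip: G.nat_pow_consistent)
    then have per: "(\<alpha> g ^^ (p ^ a)) y = y" if "y \<in> carrier N" for y
      using power[OF gc that, of "p ^ a"] \<alpha>1 that by simp
    have "g [^]\<^bsub>G\<^esub> (p ^ k) \<in> G' \<longleftrightarrow> (\<alpha> g ^^ (p ^ k)) \<one>\<^bsub>N\<^esub> = \<one>\<^bsub>N\<^esub>"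
      using stab gc power by simp
    also have "\<dots> \<longleftrightarrow> ev g [^]\<^bsub>N\<^esub> (p ^ k) = \<one>\<^bsub>N\<^esub>"
      by (rule N.affine_prime_power_fixes_one_iff[OF p ordN \<open>n < p\<close> \<phi> _ af per])
        (use evP g in auto)
    finally show ?thesis using evP g by (auto simp: torsion_def)
  qed
  then have "{g \<in> P. g [^]\<^bsub>G\<^esub> (p ^ k) \<in> G'} = {g \<in> P. ev g \<in> torsion N (p ^ k)}"
    by blast
  also have "card \<dots> = card (torsion N (p ^ k)) * card (P \<inter> G')"
    by (rule card_preimage_equal_fibres[OF finP _ fibre]) (simp add: surj torsion_def)
  finally show ?thesis by (simp add: mult.commute)
qed

section \<open>Abelian p-groups are determined by their torsion counts\<close>

text \<open>
  The cyclic factor is the model \<open>integer_mod_group\<close> and not the subgroup generated by \<open>x\<close>, so that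
  two groups with elements of the same order have literally the same first factor.
\<close>

lemma (in comm_group) cyclic_times_complement_iso:
  assumes x: "x \<in> carrier G" and q: "0 < ord x"
    and M: "subgroup M G"
    and disj: "\<And>i::int. x [^] i \<in> M \<Longrightarrow> x [^] i = \<one>"
    and gen: "\<And>y. y \<in> carrier G \<Longrightarrow> \<exists>(i::int). \<exists>m\<in>M. y = x [^] i \<otimes> m"
  shows "integer_mod_group (ord x) \<times>\<times> (G\<lparr>carrier := M\<rparr>) \<cong> G"
proof (rule is_isoI)
  let ?C = "integer_mod_group (ord x)" and ?h = "\<lambda>(i::int, m). x [^] i \<otimes> m"
  have mod: "x [^] (i mod int (ord x)) = x [^] i" for i :: int
    using x by (simp add: int_pow_eq mod_eq_dvd_iff [symmetric])
  have Mc: "m \<in> carrier G" if "m \<in> M" for m using M that subgroup.mem_carrier by metis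
  have C: "carrier ?C = {0..<int (ord x)}" using q by (simp add: carrier_integer_mod_group)
  show "?h \<in> iso (?C \<times>\<times> (G\<lparr>carrier := M\<rparr>)) G"
    unfolding iso_def bij_betw_def
  proof (safe)
    show "?h \<in> hom (?C \<times>\<times> (G\<lparr>carrier := M\<rparr>)) G"
      using x Mc by (auto simp: hom_def mod int_pow_mult m_ac)
    show "inj_on ?h (carrier (?C \<times>\<times> (G\<lparr>carrier := M\<rparr>)))"
    proof (rule inj_onI, clarsimp simp: C)
      fix i j :: int and m m'
      assume i: "0 \<le> i" "i < int (ord x)" and j: "0 \<le> j" "j < int (ord x)"
        and m: "m \<in> M" and m': "m' \<in> M" and eq: "x [^] i \<otimes> m = x [^] j \<otimes> m'"
      have "x [^] (i - j) = x [^] i \<otimes> m \<otimes> inv m \<otimes> inv (x [^] j)"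
        using x Mc[OF m] by (simp add: int_pow_diff m_assoc)
      also have "\<dots> = m' \<otimes> inv m"
        unfolding eq using x Mc[OF m] Mc[OF m'] by (simp add: m_ac)
      finally have e: "x [^] (i - j) = m' \<otimes> inv m" .
      then have "x [^] (i - j) \<in> M"
        using M m m' by (simp add: subgroup.m_closed subgroup.m_inv_closed)
      from disj[OF this] have "int (ord x) dvd i - j"
        using x by (simp add: int_pow_eq_id)
      then have ij: "i = j"
        using i j by (metis mod_eq_dvd_iff mod_pos_pos_trivial)
      with eq show "i = j \<and> m = m'"
        using x Mc[OF m] Mc[OF m'] by simp
    qed
    fix i m assume "(i, m) \<in> carrier (?C \<times>\<times> (G\<lparr>carrier := M\<rparr>))"
    then show "x [^] i \<otimes> m \<in> carrier G" using x Mc by simp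
  next
    fix y assume "y \<in> carrier G"
    then obtain i :: int and m where im: "m \<in> M" "y = x [^] i \<otimes> m" using gen by blast
    show "y \<in> ?h ` carrier (?C \<times>\<times> (G\<lparr>carrier := M\<rparr>))"
      using im q by (intro image_eqI[where x = "(i mod int (ord x), m)"]) (auto simp: C mod)
  qed
qed

lemma (in comm_group) subgroup_adjoin:
  assumes M: "subgroup M G" and z: "z \<in> carrier G"
  shows "subgroup {z [^] i \<otimes> m | (i::int) m. m \<in> M} G" (is "subgroup ?S G")
proof (rule subgroupI)
  have Mc: "m \<in> carrier G" if "m \<in> M" for m using M that subgroup.mem_carrier by metis
  show "?S \<subseteq> carrier G" using Mc z by auto
  show "?S \<noteq> {}" using subgroup.one_closed[OF M] by blast
  fix a b assume "a \<in> ?S"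
  then obtain i :: int and m where a: "a = z [^] i \<otimes> m" "m \<in> M" by blast
  have "inv a = z [^] (- i) \<otimes> inv m"
    using a z Mc by (simp add: inv_mult int_pow_neg)
  then show "inv a \<in> ?S" using subgroup.m_inv_closed[OF M a(2)] by blast
  assume "b \<in> ?S"
  then obtain j :: int and m' where b: "b = z [^] j \<otimes> m'" "m' \<in> M" by blast
  have "a \<otimes> b = z [^] (i + j) \<otimes> (m \<otimes> m')"
    using a b z Mc by (simp add: int_pow_mult[symmetric] m_ac)
  then show "a \<otimes> b \<in> ?S" using subgroup.m_closed[OF M a(2) b(2)] by blast
qed

text \<open>
  Let \<open>M\<close> be maximal among the subgroups that meet \<open>\<langle>x\<rangle>\<close> trivially, and let \<open>S = \<langle>x\<rangle> M\<close>. It suffices that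
  \<open>y\<^sup>p \<in> S\<close> implies \<open>y \<in> S\<close>. Writing \<open>y\<^sup>p = x\<^sup>r m\<close>, maximality of the order of \<open>x\<close> forces
  \<open>p dvd r\<close>, so dividing \<open>y\<close> by a power of \<open>x\<close> gives \<open>z\<close> with \<open>z\<^sup>p = m \<in> M\<close>. If \<open>z\<close> were not in \<open>S\<close>,
  then \<open>\<langle>z\<rangle> M\<close> would be larger than \<open>M\<close> and so contain some \<open>x\<^sup>t = z\<^sup>j m' \<noteq> 1\<close>. Either \<open>p dvd j\<close>,
  and \<open>x\<^sup>t\<close> lies in \<open>M\<close>; or \<open>z\<^sup>j\<close> and \<open>z\<^sup>p\<close> both lie in \<open>S\<close> with \<open>j\<close> coprime to \<open>p\<close>, and then
  so does \<open>z\<close>.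
\<close>

lemma (in comm_group) cyclic_of_maximal_order_complement:
  assumes p: "Factorial_Ring.prime p" and fin: "finite (carrier G)"
    and x: "x \<in> carrier G" and ordx: "ord x = p ^ Suc e"
    and expo: "\<And>y. y \<in> carrier G \<Longrightarrow> y [^] (p ^ Suc e) = \<one>"
  obtains M where "subgroup M G"
    and "\<And>i::int. x [^] i \<in> M \<Longrightarrow> x [^] i = \<one>"
    and "\<And>y. y \<in> carrier G \<Longrightarrow> \<exists>(i::int). \<exists>m\<in>M. y = x [^] i \<otimes> m"
proof -
  define indep where "indep M \<longleftrightarrow> subgroup M G \<and> (\<forall>i::int. x [^] i \<in> M \<longrightarrow> x [^] i = \<one>)" for M
  have "finite {M. indep M}"
    by (rule finite_subset[of _ "Pow (carrier G)"]) (use fin in \<open>auto simp: indep_def dest: subgroup.subset\<close>)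
  moreover have "indep {\<one>}" by (simp add: indep_def triv_subgroup)
  ultimately obtain M where ind: "indep M" and mx: "\<And>K. indep K \<Longrightarrow> M \<subseteq> K \<Longrightarrow> K = M"
    using finite_has_maximal[of "{M. indep M}"] by (metis empty_iff mem_Collect_eq)
  have M: "subgroup M G" and disj: "\<And>i::int. x [^] i \<in> M \<Longrightarrow> x [^] i = \<one>"
    using ind by (auto simp: indep_def)
  have Mc: "m \<in> carrier G" if "m \<in> M" for m using M that subgroup.mem_carrier by metis
  define S where "S = {x [^] i \<otimes> m | (i::int) m. m \<in> M}"
  have S: "subgroup S G" unfolding S_def by (rule subgroup_adjoin[OF M x])
  have xS: "x [^] i \<in> S" for i :: int
    unfolding S_def using x subgroup.one_closed[OF M]
    by (intro CollectI exI[of _ i] exI[of _ "\<one>"]) simp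
  have MS: "m \<in> S" if "m \<in> M" for m
    unfolding S_def using that Mc by (intro CollectI exI[of _ "0::int"] exI[of _ m]) simp
  have step: "y \<in> S" if y: "y \<in> carrier G" and yp: "y [^] p \<in> S" for y
  proof -
    obtain r :: int and m where m: "m \<in> M" and ym: "y [^] p = x [^] r \<otimes> m"
      using yp by (auto simp: S_def)
    have "\<one> = (y [^] p) [^] (p ^ e)"
      using expo[OF y] y by (simp add: nat_pow_pow)
    also have "\<dots> = x [^] (r * int (p ^ e)) \<otimes> m [^] (p ^ e)"
      unfolding ym using x Mc[OF m] by (simp add: int_pow_distrib int_pow_pow flip: int_pow_int)
    finally have "x [^] (r * int (p ^ e)) = inv (m [^] (p ^ e))"
      using x Mc[OF m] by (metis int_pow_closed inv_equality nat_pow_closed)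
    then have "x [^] (r * int (p ^ e)) \<in> M"
      using subgroup.m_inv_closed[OF M] subgroup_int_pow_closed[OF M m] by (metis int_pow_int)
    from disj[OF this] have "int (p ^ Suc e) dvd r * int (p ^ e)"
      using x ordx by (simp add: int_pow_eq_id)
    then have "int p dvd r"
      using prime_gt_0_nat[OF p] by (simp add: mult.commute)
    then obtain s where s: "r = int p * s" ..
    define z where "z = y \<otimes> x [^] (- s)"
    have zc: "z \<in> carrier G" using y x by (simp add: z_def)
    have yz: "y = z \<otimes> x [^] s"
      using x y by (simp add: z_def int_pow_neg m_assoc)
    have "z [^] p = y [^] p \<otimes> x [^] (- r)"
      using x y unfolding z_def s
      by (simp add: int_pow_distrib int_pow_pow mult.commute flip: int_pow_int)
    also have "\<dots> = m"
      unfolding ym using x Mc[OF m] by (simp add: m_ac int_pow_neg)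
    finally have zp: "z [^] p = m" .
    have zS: "z \<in> S"
    proof (rule ccontr)
      assume nz: "z \<notin> S"
      define K where "K = {z [^] i \<otimes> m | (i::int) m. m \<in> M}"
      have K: "subgroup K G" unfolding K_def by (rule subgroup_adjoin[OF M zc])
      have MK: "M \<subseteq> K"
      proof
        fix m assume "m \<in> M"
        then show "m \<in> K"
          unfolding K_def using Mc by (intro CollectI exI[of _ "0::int"] exI[of _ m]) simp
      qed
      have "z \<in> K"
        unfolding K_def using zc subgroup.one_closed[OF M]
        by (intro CollectI exI[of _ "1::int"] exI[of _ "\<one>"]) simp
      then have "K \<noteq> M" using nz MS by blast
      then have "\<not> indep K" using mx MK by blast
      then obtain t :: int where t: "x [^] t \<in> K" "x [^] t \<noteq> \<one>"
        using K by (auto simp: indep_def)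
      then obtain j :: int and m' where m': "m' \<in> M" and xt: "x [^] t = z [^] j \<otimes> m'"
        by (auto simp: K_def)
      have zpj: "z [^] (int p * i) \<in> M" for i :: int
        using subgroup_int_pow_closed[OF M m, of i] zp zc by (metis int_pow_int int_pow_pow)
      show False
      proof (cases "int p dvd j")
        case True
        then have "x [^] t \<in> M"
          unfolding xt using zpj m' subgroup.m_closed[OF M] by auto
        then show False using disj t by blast
      next
        case False
        then have "coprime (int p) j"
          using p by (simp add: prime_imp_coprime)
        then obtain u v where uv: "u * int p + v * j = 1"
          using bezout_int[of "int p" j] by auto
        have "z [^] j = x [^] t \<otimes> inv m'"
          unfolding xt using zc Mc[OF m'] by (simp add: m_assoc)
        then have zj: "z [^] j \<in> S"
          using xS MS[OF m'] S by (simp add: subgroup.m_closed subgroup.m_inv_closed)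
        have "z = z [^] (int p * u) \<otimes> (z [^] j) [^] v"
          using zc uv by (simp add: int_pow_pow int_pow_mult[symmetric] mult.commute)
        also have "\<dots> \<in> S"
          using MS[OF zpj] subgroup_int_pow_closed[OF S zj] S by (simp add: subgroup.m_closed)
        finally show False using nz by blast
      qed
    qed
    show "y \<in> S"
      unfolding yz using zS xS subgroup.m_closed[OF S] by blast
  qed
  have "y [^] (p ^ k) \<in> S \<Longrightarrow> y \<in> carrier G \<Longrightarrow> y \<in> S" for y k
  proof (induction k arbitrary: y)
    case (Suc k)
    have "(y [^] p) [^] (p ^ k) \<in> S" using Suc.prems by (simp add: nat_pow_pow)
    then have "y [^] p \<in> S"
      by (rule Suc.IH) (simp add: Suc.prems)
    then show ?case by (rule step[OF Suc.prems(2)])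
  qed simp
  then have "y \<in> S" if "y \<in> carrier G" for y
    using expo[OF that] subgroup.one_closed[OF S] that by metis
  then show thesis
    using that[OF M disj] unfolding S_def by blast
qed

text \<open>
  Induction on the order. The exponent of a group can be read off from its torsion counts, so both
  groups have elements of the same maximal order; splitting off the cyclic groups that they generate
  divides both torsion counts by the same number, and the induction hypothesis applies to the
  complements.
\<close>

lemma comm_p_groups_iso_if_torsion_eq:
  fixes G :: "('a, 'c) monoid_scheme" and H :: "('b, 'd) monoid_scheme"
  assumes "Factorial_Ring.prime p" "comm_group G" "comm_group H"
    and "order G = p ^ n" "order H = p ^ n"
    and "\<And>k. card (torsion G (p ^ k)) = card (torsion H (p ^ k))"
  shows "G \<cong> H"
  using assms
proof (induction n arbitrary: G H rule: less_induct)
  case (less n)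
  note p = less.prems(1) and tors = less.prems(6)
  interpret G: comm_group G by fact
  interpret H: comm_group H by fact
  have finG: "finite (carrier G)" and finH: "finite (carrier H)"
    using less.prems(4,5) p
    by (metis G.order_gt_0_iff_finite prime_gt_0_nat zero_less_power,
        metis H.order_gt_0_iff_finite prime_gt_0_nat zero_less_power)
  show ?case
  proof (cases "n = 0")
    case True
    have "card (carrier G) = 1" "card (carrier H) = 1"
      using less.prems(4,5) True by (auto simp: order_def)
    then have "carrier G = {\<one>\<^bsub>G\<^esub>}" "carrier H = {\<one>\<^bsub>H\<^esub>}"
      using G.one_closed H.one_closed by (metis card_1_singletonE singletonD)+
    then have "(\<lambda>_. \<one>\<^bsub>H\<^esub>) \<in> iso G H"
      by (auto simp: iso_def hom_def bij_betw_def)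
    then show ?thesis by (rule is_isoI)
  next
    case False
    \<comment> \<open>\<open>p\<^sup>e\<close> is the exponent of \<open>G\<close>, expressed through torsion counts and hence also the exponent
      of \<open>H\<close>.\<close>
    define e where "e = (LEAST e. card (torsion G (p ^ e)) = p ^ n)"
    have eqG: "card (torsion G m) = p ^ n \<longleftrightarrow> (\<forall>y\<in>carrier G. y [^]\<^bsub>G\<^esub> m = \<one>\<^bsub>G\<^esub>)" for m
      using G.card_torsion_eq_order_iff[OF finG] less.prems(4) by simp
    have eqH: "card (torsion H m) = p ^ n \<longleftrightarrow> (\<forall>y\<in>carrier H. y [^]\<^bsub>H\<^esub> m = \<one>\<^bsub>H\<^esub>)" for m
      using H.card_torsion_eq_order_iff[OF finH] less.prems(5) by simp
    have "card (torsion G (p ^ n)) = p ^ n"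
      unfolding eqG using G.pow_order_eq_1 less.prems(4) by simp
    then have e: "card (torsion G (p ^ e)) = p ^ n"
      unfolding e_def by (rule LeastI)
    have "e \<noteq> 0"
    proof
      assume "e = 0"
      with e have "\<forall>y\<in>carrier G. y = \<one>\<^bsub>G\<^esub>" unfolding eqG by simp
      then have "carrier G = {\<one>\<^bsub>G\<^esub>}" by auto
      then show False
        using less.prems(4) False one_less_power[OF prime_gt_1_nat[OF p], of n] by (simp add: order_def)
    qed
    then obtain d where d: "e = Suc d" using not0_implies_Suc by blast
    have nd: "card (torsion G (p ^ d)) \<noteq> p ^ n"
      using not_less_Least[of d "\<lambda>e. card (torsion G (p ^ e)) = p ^ n"] d e_def by simp
    have expG: "y [^]\<^bsub>G\<^esub> (p ^ Suc d) = \<one>\<^bsub>G\<^esub>" if "y \<in> carrier G" for y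
      using e that unfolding eqG d by blast
    have expH: "y [^]\<^bsub>H\<^esub> (p ^ Suc d) = \<one>\<^bsub>H\<^esub>" if "y \<in> carrier H" for y
      using e that unfolding tors eqH d by blast
    obtain x where x: "x \<in> carrier G" "x [^]\<^bsub>G\<^esub> (p ^ d) \<noteq> \<one>\<^bsub>G\<^esub>"
      using nd unfolding eqG by blast
    obtain y where y: "y \<in> carrier H" "y [^]\<^bsub>H\<^esub> (p ^ d) \<noteq> \<one>\<^bsub>H\<^esub>"
      using nd unfolding tors eqH by blast
    have pw: "m = p ^ Suc d" if "m dvd p ^ Suc d" "\<not> m dvd p ^ d" for m
    proof -
      from that(1) obtain f where f: "f \<le> Suc d" "m = p ^ f"
        using divides_primepow_nat[OF p] by blast
      with that(2) have "f = Suc d" by (metis le_Suc_eq le_imp_power_dvd)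
      with f show ?thesis by simp
    qed
    have ox: "G.ord x = p ^ Suc d"
      by (rule pw) (use x expG G.pow_eq_id in blast)+
    have oy: "H.ord y = p ^ Suc d"
      by (rule pw) (use y expH H.pow_eq_id in blast)+
    obtain M where M: "subgroup M G" "\<And>i::int. x [^]\<^bsub>G\<^esub> i \<in> M \<Longrightarrow> x [^]\<^bsub>G\<^esub> i = \<one>\<^bsub>G\<^esub>"
      "\<And>y. y \<in> carrier G \<Longrightarrow> \<exists>(i::int). \<exists>m\<in>M. y = x [^]\<^bsub>G\<^esub> i \<otimes>\<^bsub>G\<^esub> m"
      using G.cyclic_of_maximal_order_complement[OF p finG x(1) ox expG] by metis
    obtain L where L: "subgroup L H" "\<And>i::int. y [^]\<^bsub>H\<^esub> i \<in> L \<Longrightarrow> y [^]\<^bsub>H\<^esub> i = \<one>\<^bsub>H\<^esub>"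
      "\<And>z. z \<in> carrier H \<Longrightarrow> \<exists>(i::int). \<exists>m\<in>L. z = y [^]\<^bsub>H\<^esub> i \<otimes>\<^bsub>H\<^esub> m"
      using H.cyclic_of_maximal_order_complement[OF p finH y(1) oy expH] by metis
    let ?C = "integer_mod_group (p ^ Suc d)"
    let ?M = "G\<lparr>carrier := M\<rparr>" and ?L = "H\<lparr>carrier := L\<rparr>"
    have q: "0 < p ^ Suc d" using p by (simp add: prime_gt_0_nat)
    have isoG: "?C \<times>\<times> ?M \<cong> G"
      using G.cyclic_times_complement_iso[OF x(1) _ M] q unfolding ox by blast
    have isoH: "?C \<times>\<times> ?L \<cong> H"
      using H.cyclic_times_complement_iso[OF y(1) _ L] q unfolding oy by blast
    have cM: "comm_group ?M" 
      using group.group_comm_groupI[OF G.subgroup_imp_group[OF M(1)]] G.m_comm subgroup.mem_carrier[OF M(1)]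
      by simp
    have cL: "comm_group ?L" 
      using group.group_comm_groupI[OF H.subgroup_imp_group[OF L(1)]] H.m_comm subgroup.mem_carrier[OF L(1)]
      by simp
    have gM: "group ?M" and gL: "group ?L"
      using G.subgroup_imp_group[OF M(1)] H.subgroup_imp_group[OF L(1)] by blast+
    have "card (carrier (integer_mod_group m)) = m" if "0 < m" for m
      using that by (simp add: carrier_integer_mod_group)
    from this[OF q] have cC: "card (carrier ?C) = p ^ Suc d" .
    have oM: "p ^ Suc d * order ?M = p ^ n"
      using iso_same_card[OF isoG] less.prems(4) cC by (simp add: order_def card_cartesian_product)
    have oL: "p ^ Suc d * order ?L = p ^ n"
      using iso_same_card[OF isoH] less.prems(5) cC by (simp add: order_def card_cartesian_product)
    have "order ?M dvd p ^ n" using oM by (metis dvd_triv_right)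
    then obtain f where f: "order ?M = p ^ f" using divides_primepow_nat[OF p, of _ n] by auto
    have "p ^ (Suc d + f) = p ^ n" using oM f by (simp only: power_add)
    then have "Suc d + f = n" using prime_gt_1_nat[OF p] by (simp only: power_inject_exp)
    then have "f < n" by simp
    have fL: "order ?L = p ^ f" using oM oL f q by (metis mult_cancel1 less_irrefl_nat)
    have tt: "card (torsion ?M (p ^ k)) = card (torsion ?L (p ^ k))" for k
    proof -
      have "card (torsion ?C (p ^ k)) * card (torsion ?M (p ^ k))
          = card (torsion ?C (p ^ k)) * card (torsion ?L (p ^ k))"
        using card_torsion_iso[OF isoG] card_torsion_iso[OF isoH] tors[of k]
          DirProd_group[OF group_integer_mod_group gM] DirProd_group[OF group_integer_mod_group gL]
        by (simp add: card_torsion_DirProd G.is_group H.is_group)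
      moreover have "0 < card (torsion ?C (p ^ k))"
        by (rule group.card_torsion_pos) (use q in \<open>auto simp: carrier_integer_mod_group\<close>)
      ultimately show ?thesis by simp
    qed
    have "?M \<cong> ?L"
      by (rule less.IH[OF \<open>f < n\<close> p cM cL f fL tt])
    then have isoC: "?C \<times>\<times> ?M \<cong> ?C \<times>\<times> ?L"
      using group.DirProd_iso_trans[OF group_integer_mod_group iso_refl] by blast
    have "G \<cong> ?C \<times>\<times> ?M"
      using group.iso_sym[OF _ isoG] DirProd_group[OF group_integer_mod_group gM] by blast
    then show ?thesis
      by (rule iso_trans[OF _ iso_trans[OF isoC isoH]])
  qed
qed

section \<open>Uniqueness of the realizable abelian group\<close>

theorem theorem6:
  fixes p n :: nat
    and N1 :: "('a, 'c) monoid_scheme"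
    and N2 :: "('b, 'd) monoid_scheme"
    and G :: "('g, 'e) monoid_scheme"
    and G' :: "'g set"
  assumes "Factorial_Ring.prime p" and "n \<ge> 3" and "p > n"
    and "comm_group N1" and "order N1 = p ^ n"
    and "comm_group N2" and "order N2 = p ^ n"
    and "group G" and "subgroup G' G" and "card (rcosets\<^bsub>G\<^esub> G') = p ^ n"
    and "realizable G G' N1" and "realizable G G' N2"
  shows "N1 \<cong> N2"
proof -
  note p = assms(1)
  have fin: "finite (carrier G)" using assms(11) by (simp add: realizable_def)
  then have "order G \<noteq> 0"
    using monoid.order_gt_0_iff_finite[OF group.is_monoid[OF assms(8)]] by simp
  moreover have "\<not> is_unit p" using p by (auto simp: prime_nat_iff)
  ultimately obtain m where m: "order G = p ^ multiplicity p (order G) * m" "\<not> p dvd m"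
    using multiplicity_decompose' by metis
  obtain P where P: "subgroup P G" "card P = p ^ multiplicity p (order G)"
    using sylow_thm[OF p assms(8) m(1) fin] by blast
  have "finite P" using P(1) fin subgroup.subset finite_subset by metis
  moreover have "\<one>\<^bsub>G\<^esub> \<in> P \<inter> G'"
    using P(1) assms(9) by (simp add: subgroup.one_closed)
  ultimately have pos: "0 < card (P \<inter> G')" by (auto simp: card_gt_0_iff)
  have "card (torsion N1 (p ^ k)) = card (torsion N2 (p ^ k))" for k
    using card_prime_power_roots_of_stabilizer[OF p assms(3,4,5,11) P m, of k]
      card_prime_power_roots_of_stabilizer[OF p assms(3,6,7,12) P m, of k] pos
    by simp
  then show ?thesis
    by (rule comm_p_groups_iso_if_torsion_eq[OF p assms(4,6,5,7)])
qed

end
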